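(* Let $\lambda\in\mathbb{R}$ with $\lambda>1$. There exists an $s>0$ such that $\lambda$ is an $s$-deformed Laplacian limit point. Precisely, $\lambda=\lim_{n\to\infty}\rho(M_{T_{1,n,n}}(s))$ for some $s\in\mathbb{R}$.
   Context: For a finite simple undirected graph $G$ with adjacency matrix $A$ and diagonal degree matrix $D$, and $s\in\mathbb{R}$, the deformed Laplacian matrix of $G$ is $M_G(s)=I-sA+s^2(D-I)$. It is real symmetric; $\rho(M_G(s))$ denotes its spectral radius (for trees this is also its largest eigenvalue). A number $\lambda\in\mathbb{R}$ is an $s$-deformed Laplacian limit point (for a fixed $s\in\mathbb{R}$) if there exists a sequence of graphs $(G_n)_{n\in\mathbb{N}}$ such that $\rho(M_{G_i}(s))\neq\rho(M_{G_j}(s))$ for $i\neq j$ and $\lim_{n\to\infty}\rho(M_{G_n}(s))=\lambda$. For $n\ge 1$, $T_{1,n,n}$ is the tree formed by a vertex $u$ to which one attaches (by joining $u$ to an end vertex of each path) a path $P_1$ and two paths $P_n$, where $P_m$ is the path on $m$ vertices. *)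

theory Defs
  imports
    "Graph_Theory.Pair_Digraph"
    "Jordan_Normal_Form.Spectral_Radius"
begin

text \<open>
  Finite simple undirected graphs are the library's \<^locale>\<open>pair_graph\<close>: an undirected edge
  is a pair of opposite arcs. Row and column \<open>i\<close> of the matrices below belong to the \<open>i\<close>-th
  smallest vertex.
\<close>

definition vertex_list :: "'a::linorder pair_pre_digraph \<Rightarrow> 'a list" where
  "vertex_list G = sorted_list_of_set (pverts G)"

definition adjacency_matrix :: "'a::linorder pair_pre_digraph \<Rightarrow> real mat" where
  "adjacency_matrix G =
     mat (card (pverts G)) (card (pverts G))
       (\<lambda>(i, j). if (vertex_list G ! i, vertex_list G ! j) \<in> parcs G then 1 else 0)"

definition degree_matrix :: "'a::linorder pair_pre_digraph \<Rightarrow> real mat" where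
  "degree_matrix G =
     mat (card (pverts G)) (card (pverts G))
       (\<lambda>(i, j). if i = j then real (out_degree (with_proj G) (vertex_list G ! i)) else 0)"

definition deformed_laplacian :: "'a::linorder pair_pre_digraph \<Rightarrow> real \<Rightarrow> real mat" where
  "deformed_laplacian G s =
     (let I = 1\<^sub>m (card (pverts G)) in
      I - s \<cdot>\<^sub>m adjacency_matrix G + s\<^sup>2 \<cdot>\<^sub>m (degree_matrix G - I))"

text \<open>
  \<^const>\<open>spectral_radius\<close> is only available for complex matrices; it is a maximum over
  the spectrum and hence unspecified for the graph without vertices.
\<close>

definition deformed_laplacian_radius :: "'a::linorder pair_pre_digraph \<Rightarrow> real \<Rightarrow> real" where
  "deformed_laplacian_radius G s =
     spectral_radius (map_mat complex_of_real (deformed_laplacian G s))"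

text \<open>Every finite graph is isomorphic to one whose vertices are natural numbers.\<close>

definition deformed_laplacian_limit_point :: "real \<Rightarrow> real \<Rightarrow> bool" where
  "deformed_laplacian_limit_point s l \<longleftrightarrow>
     (\<exists>G :: nat \<Rightarrow> nat pair_pre_digraph.
        (\<forall>n. pair_graph (G n) \<and> pverts (G n) \<noteq> {}) \<and>
        (\<forall>i j. i \<noteq> j \<longrightarrow>
           deformed_laplacian_radius (G i) s \<noteq> deformed_laplacian_radius (G j) s) \<and>
        (\<lambda>n. deformed_laplacian_radius (G n) s) \<longlonglongrightarrow> l)"

text \<open>
  The tree \<open>T\<^bsub>a,b,c\<^esub>\<close>: the centre is \<open>0\<close>, and the attached paths on \<open>a\<close>, \<open>b\<close> and \<open>c\<close> vertices
  are the blocks \<open>{1..a}\<close>, \<open>{a+1..a+b}\<close> and \<open>{a+b+1..a+b+c}\<close>. The predecessor of a non-central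
  vertex is its neighbour in the direction of the centre.
\<close>

definition tree_T_pred :: "nat \<Rightarrow> nat \<Rightarrow> nat \<Rightarrow> nat" where
  "tree_T_pred a b v = (if v \<in> {1, a + 1, a + b + 1} then 0 else v - 1)"

definition tree_T :: "nat \<Rightarrow> nat \<Rightarrow> nat \<Rightarrow> nat pair_pre_digraph" where
  "tree_T a b c =
     (let E = (\<lambda>v. (tree_T_pred a b v, v)) ` {1..a + b + c}
      in \<lparr>pverts = {0..a + b + c}, parcs = E \<union> E\<inverse>\<rparr>)"

lemma pair_graph_tree_T: "pair_graph (tree_T a b c)"
proof
  have pred: "tree_T_pred a b v < v" if "v \<ge> 1" for v
    using that by (auto simp: tree_T_pred_def)
  have arc: "fst e \<in> {0..a + b + c} \<and> snd e \<in> {0..a + b + c} \<and> fst e \<noteq> snd e"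
    if "e \<in> parcs (tree_T a b c)" for e
    using that pred by (force simp: tree_T_def Let_def dest: less_imp_le)
  show "fst e \<in> pverts (tree_T a b c)" "snd e \<in> pverts (tree_T a b c)" "fst e \<noteq> snd e"
    if "e \<in> parcs (tree_T a b c)" for e
    using arc[OF that] by (simp_all add: tree_T_def Let_def)
  show "finite (pverts (tree_T a b c))" "finite (parcs (tree_T a b c))"
    by (simp_all add: tree_T_def Let_def)
  show "symmetric (with_proj (tree_T a b c))"
    by (auto simp: symmetric_def tree_T_def Let_def intro!: symI)
qed

end

theory Submission
  imports Defs
begin

text \<open>
  A tree is bipartite, so changing the sign of the coordinates in one colour class turns
  \<open>M(s) = I - sA + s\<^sup>2(D - I)\<close> into the matrix \<open>I + sA + s\<^sup>2(D - I)\<close>. Its entries are nonnegative for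
  \<open>s > 0\<close> as soon as the tree has an edge. If a nonnegative matrix has a positive eigenvector, the
  eigenvalue belonging to it is the spectral radius (\<open>deformed_laplacian_radius_eqI\<close>). Computing
  the radius of \<open>T\<^bsub>1,n,n\<^esub>\<close> therefore amounts to writing down one positive eigenvector.

  Write the eigenvalue as \<open>\<mu>(w) = 1 + s\<^sup>2 + s(w + 1/w)\<close> with \<open>w > 1\<close>. Along a path the eigenvalue
  equation is a linear recurrence with characteristic roots \<open>w\<close> and \<open>1/w\<close>, and the leaf fixes its
  solution \<open>y\<^sub>j\<close> up to scaling, where \<open>j\<close> is the distance from the leaf; this solution is positive. The
  single pendant vertex contributes the factor \<open>s/(\<mu>(w) - 1)\<close>. Hence the three branches fit
  together to a positive eigenvector exactly if the equation at the centre holds, which reads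
  \<open>s(w + 1/w) = s\<^sup>2 + s\<^sup>2/(\<mu>(w) - 1) + 2s y\<^bsub>n-1\<^esub>/y\<^sub>n\<close> (\<open>tree_T_radius\<close>).

  Since \<open>y\<^bsub>n-1\<^esub>/y\<^sub>n\<close> is less than \<open>1/w\<close> and tends to \<open>1/w\<close>, the limiting equation is
  \<open>w - 1/w = s \<mu>(w)/(\<mu>(w) - 1)\<close>. Given \<open>l > 1\<close>, the intermediate value theorem yields \<open>s\<close> and a
  solution \<open>W\<close> of it with \<open>\<mu>(W) = l\<close> (\<open>limit_parameters_exist\<close>). For every \<open>a\<close> in
  \<open>(1, W)\<close> and all large \<open>n\<close>, the left side of the centre equation minus the right one is
  negative at \<open>a\<close> and positive at \<open>W\<close>, so the equation has a solution in between
  (\<open>eventually_radius_between\<close>). Thus the radii tend to \<open>l\<close> and eventually lie strictly below it,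
  and a strictly increasing subsequence makes them pairwise different.
\<close>

section \<open>Spectral radius from a positive eigenvector\<close>

text \<open>
  The vector \<open>\<sigma> x\<close> is an eigenvector of the matrix itself, so \<open>\<mu>\<close> is attained. That no eigenvalue
  is larger in modulus follows by comparing its eigenvector \<open>v\<close> with \<open>x\<close> at an index where
  \<open>\<bar>v\<^sub>i\<bar>/x\<^sub>i\<close> is maximal: the triangle inequality in that row gives the bound. This is the part of the
  Perron--Frobenius theorem that applies when the positive eigenvector is given.
\<close>

lemma spectral_radius_eqI_positive_vector:
  fixes A :: "real mat" and x \<sigma> :: "nat \<Rightarrow> real"
  assumes A: "A \<in> carrier_mat n n" and n: "n > 0"
    and pos: "\<And>i. i < n \<Longrightarrow> x i > 0"
    and eig: "\<And>i. i < n \<Longrightarrow> (\<Sum>j<n. \<bar>A $$ (i, j)\<bar> * x j) = \<mu> * x i"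
    and unit: "\<And>i. i < n \<Longrightarrow> \<bar>\<sigma> i\<bar> = 1"
    and sign: "\<And>i j. i < n \<Longrightarrow> j < n \<Longrightarrow> A $$ (i, j) * \<sigma> j = \<sigma> i * \<bar>A $$ (i, j)\<bar>"
  shows "spectral_radius (map_mat complex_of_real A) = \<mu>"
proof -
  let ?B = "map_mat complex_of_real A"
  have B: "?B \<in> carrier_mat n n" using A by simp
  have row: "(?B *\<^sub>v v) $ i = (\<Sum>j<n. complex_of_real (A $$ (i, j)) * v $ j)"
    if "i < n" "v \<in> carrier_vec n" for i and v :: "complex vec"
    using that A by (simp add: scalar_prod_def lessThan_atLeast0)
  have \<mu>_nonneg: "\<mu> \<ge> 0"
  proof -
    have "0 \<le> (\<Sum>j<n. \<bar>A $$ (0, j)\<bar> * x j)"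
      using pos by (intro sum_nonneg mult_nonneg_nonneg) (auto intro: less_imp_le)
    then show ?thesis using eig[OF n] pos[OF n] by (simp add: zero_le_mult_iff)
  qed
  have upper: "cmod \<nu> \<le> \<mu>" if \<nu>: "eigenvalue ?B \<nu>" for \<nu>
  proof -
    obtain v where v: "v \<in> carrier_vec n" "v \<noteq> 0\<^sub>v n" "?B *\<^sub>v v = \<nu> \<cdot>\<^sub>v v"
      using \<nu> A unfolding eigenvalue_def eigenvector_def by auto
    let ?r = "\<lambda>i. cmod (v $ i) / x i"
    let ?m = "Max (?r ` {..<n})"
    have "?m \<in> ?r ` {..<n}" using n by (intro Max_in) auto
    then obtain i where i: "i < n" "?r i = ?m" by auto
    have le: "cmod (v $ j) \<le> ?r i * x j" if "j < n" for j
    proof -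
      have "?r j \<le> ?r i" unfolding i(2) using that by (intro Max_ge) auto
      then show ?thesis using pos[OF that] by (simp add: pos_divide_le_eq)
    qed
    have vi: "cmod (v $ i) > 0"
    proof (rule ccontr)
      assume "\<not> cmod (v $ i) > 0"
      then have "v $ i = 0" by simp
      then have "v $ j = 0" if "j < n" for j using le[OF that] by simp
      then have "v = 0\<^sub>v n" using v(1) by (intro eq_vecI) auto
      then show False using v(2) by contradiction
    qed
    have "cmod \<nu> * cmod (v $ i) = cmod ((?B *\<^sub>v v) $ i)"
      using v i by (simp add: norm_mult)
    also have "\<dots> = cmod (\<Sum>j<n. complex_of_real (A $$ (i, j)) * v $ j)"
      using row[OF i(1) v(1)] by simp
    also have "\<dots> \<le> (\<Sum>j<n. \<bar>A $$ (i, j)\<bar> * cmod (v $ j))"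
      by (rule order_trans[OF norm_sum]) (simp add: norm_mult)
    also have "\<dots> \<le> (\<Sum>j<n. \<bar>A $$ (i, j)\<bar> * (?r i * x j))"
      using le by (intro sum_mono mult_left_mono) auto
    also have "\<dots> = ?r i * (\<Sum>j<n. \<bar>A $$ (i, j)\<bar> * x j)"
      by (simp only: sum_distrib_left mult.left_commute)
    also have "\<dots> = \<mu> * cmod (v $ i)"
      using eig[OF i(1)] pos[OF i(1)] by simp
    finally show ?thesis using vi by simp
  qed
  have ev: "eigenvalue ?B (complex_of_real \<mu>)"
  proof -
    let ?v = "vec n (\<lambda>i. complex_of_real (\<sigma> i * x i))"
    have "(?B *\<^sub>v ?v) $ i = (complex_of_real \<mu> \<cdot>\<^sub>v ?v) $ i" if i: "i < n" for i
    proof -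
      have "(?B *\<^sub>v ?v) $ i = complex_of_real (\<Sum>j<n. A $$ (i, j) * \<sigma> j * x j)"
        using row[OF i, of ?v] by (simp add: mult.assoc)
      also have "(\<Sum>j<n. A $$ (i, j) * \<sigma> j * x j) = \<sigma> i * (\<Sum>j<n. \<bar>A $$ (i, j)\<bar> * x j)"
        using sign[OF i] by (simp add: sum_distrib_left mult.assoc)
      also have "\<dots> = \<mu> * (\<sigma> i * x i)" using eig[OF i] by simp
      finally show ?thesis using i by simp
    qed
    then have "?B *\<^sub>v ?v = complex_of_real \<mu> \<cdot>\<^sub>v ?v" using A by (intro eq_vecI) auto
    moreover have "?v \<noteq> 0\<^sub>v n"
    proof
      assume "?v = 0\<^sub>v n"
      then have "?v $ 0 = 0\<^sub>v n $ 0" by simp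
      then show False using n pos[OF n] unit[OF n] by auto
    qed
    ultimately show ?thesis using A unfolding eigenvalue_def eigenvector_def
      by (intro exI[of _ ?v]) auto
  qed
  have "Max (cmod ` spectrum ?B) = \<mu>"
  proof (rule Max_eqI)
    show "finite (cmod ` spectrum ?B)" using card_finite_spectrum(1)[OF B] by simp
    show "a \<le> \<mu>" if "a \<in> cmod ` spectrum ?B" for a
      using that upper by (auto simp: spectrum_def)
    have "cmod (complex_of_real \<mu>) \<in> cmod ` spectrum ?B"
      by (rule imageI) (simp add: spectrum_def ev)
    then show "\<mu> \<in> cmod ` spectrum ?B" using \<mu>_nonneg by simp
  qed
  then show ?thesis by (simp add: spectral_radius_def)
qed

definition neighbours :: "'a pair_pre_digraph \<Rightarrow> 'a \<Rightarrow> 'a set" where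
  "neighbours G v = {u. (v, u) \<in> parcs G}"

text \<open>
  The alternating signs \<open>\<sigma>\<close> are a proper 2-colouring of the graph. Having no isolated vertex keeps
  the diagonal entries \<open>1 + s\<^sup>2(deg v - 1)\<close> nonnegative, so that taking absolute values only
  reverses the sign of the adjacency part.
\<close>

lemma deformed_laplacian_radius_eqI:
  fixes G :: "'a::linorder pair_pre_digraph" and x \<sigma> :: "'a \<Rightarrow> real"
  assumes G: "pair_graph G" "pverts G \<noteq> {}" and s: "s \<ge> 0"
    and no_isolated: "\<And>v. v \<in> pverts G \<Longrightarrow> neighbours G v \<noteq> {}"
    and pos: "\<And>v. v \<in> pverts G \<Longrightarrow> x v > 0"
    and eig: "\<And>v. v \<in> pverts G \<Longrightarrow>
      (1 + s\<^sup>2 * (real (card (neighbours G v)) - 1)) * x v + s * (\<Sum>u\<in>neighbours G v. x u) = \<mu> * x v"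
    and unit: "\<And>v. \<bar>\<sigma> v\<bar> = 1"
    and alternating: "\<And>u v. (u, v) \<in> parcs G \<Longrightarrow> \<sigma> v = - \<sigma> u"
  shows "deformed_laplacian_radius G s = \<mu>"
proof -
  interpret pair_graph G by fact
  let ?n = "card (pverts G)" and ?v = "\<lambda>i. vertex_list G ! i"
  let ?A = "deformed_laplacian G s"
  have bij: "bij_betw ?v {..<?n} (pverts G)"
    using bij_betw_nth[of "vertex_list G"] by (simp add: vertex_list_def)
  have inV: "?v i \<in> pverts G" if "i < ?n" for i using bij that by (auto simp: bij_betw_def)
  have inj: "?v i = ?v j \<longleftrightarrow> i = j" if "i < ?n" "j < ?n" for i j
    using bij that by (auto simp: bij_betw_def inj_on_def)
  have sub: "neighbours G v \<subseteq> pverts G" for v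
    by (auto simp: neighbours_def dest: wellformed(2)[where e="(_,_)"] in_arcsD2)
  have fin: "finite (neighbours G v)" for v by (rule finite_subset[OF sub]) simp
  have deg: "out_degree (with_proj G) v = card (neighbours G v)" for v
  proof -
    have "out_arcs (with_proj G) v = Pair v ` neighbours G v"
      by (auto simp: out_arcs_def neighbours_def)
    then show ?thesis by (simp add: out_degree_def card_image inj_on_def)
  qed
  have deg_pos: "real (card (neighbours G v)) \<ge> 1" if "v \<in> pverts G" for v
    using no_isolated[OF that] fin[of v] by (simp add: Suc_le_eq card_gt_0_iff)
  have loop: "(v, v) \<notin> parcs G" for v using no_loops by force
  define d where "d v = 1 + s\<^sup>2 * (real (card (neighbours G v)) - 1)" for v
  have d_nonneg: "d v \<ge> 0" if "v \<in> pverts G" for v using deg_pos[OF that] by (simp add: d_def)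
  have entry: "?A $$ (i, j) = (if ?v i = ?v j then d (?v i) else 0)
      - s * (if ?v j \<in> neighbours G (?v i) then 1 else 0)"
    if "i < ?n" "j < ?n" for i j
    using that inj[OF that] loop
    by (auto simp: deformed_laplacian_def adjacency_matrix_def degree_matrix_def Let_def deg d_def
        neighbours_def)
  have abs_entry: "\<bar>?A $$ (i, j)\<bar> = (if ?v j = ?v i then d (?v i) else 0)
      + s * (if ?v j \<in> neighbours G (?v i) then 1 else 0)"
    if "i < ?n" "j < ?n" for i j
    using entry[OF that] d_nonneg[OF inV[OF that(1)]] s loop by (auto simp: neighbours_def)
  show ?thesis unfolding deformed_laplacian_radius_def
  proof (rule spectral_radius_eqI_positive_vector[where n = ?n
        and x = "\<lambda>i. x (?v i)" and \<sigma> = "\<lambda>i. \<sigma> (?v i)"])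
    show "?A \<in> carrier_mat ?n ?n"
      by (auto simp: deformed_laplacian_def adjacency_matrix_def degree_matrix_def Let_def)
    show "?n > 0" using G(2) by (simp add: card_gt_0_iff)
    show "\<bar>\<sigma> (?v i)\<bar> = 1" for i by (rule unit)
  next
    fix i assume i: "i < ?n"
    show "x (?v i) > 0" using pos inV[OF i] .
    have "(\<Sum>j<?n. \<bar>?A $$ (i, j)\<bar> * x (?v j))
        = (\<Sum>j<?n. ((if ?v j = ?v i then d (?v i) else 0)
             + s * (if ?v j \<in> neighbours G (?v i) then 1 else 0)) * x (?v j))"
      using abs_entry[OF i] by simp
    also have "\<dots> = (\<Sum>u\<in>pverts G. ((if u = ?v i then d (?v i) else 0)
             + s * (if u \<in> neighbours G (?v i) then 1 else 0)) * x u)"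
      by (rule sum.reindex_bij_betw[OF bij])
    also have "\<dots> = (\<Sum>u\<in>pverts G. if u = ?v i then d (?v i) * x u else 0)
             + (\<Sum>u\<in>pverts G. if u \<in> neighbours G (?v i) then s * x u else 0)"
      by (subst sum.distrib[symmetric], rule sum.cong) (auto simp: algebra_simps)
    also have "\<dots> = d (?v i) * x (?v i) + s * (\<Sum>u\<in>neighbours G (?v i). x u)"
      using inV[OF i] sub[of "?v i"]
      by (simp add: sum.inter_restrict[symmetric] Int_absorb1 sum_distrib_left)
    also have "\<dots> = \<mu> * x (?v i)" using eig[OF inV[OF i]] by (simp add: d_def)
    finally show "(\<Sum>j<?n. \<bar>?A $$ (i, j)\<bar> * x (?v j)) = \<mu> * x (?v i)" .
  next
    fix i j assume ij: "i < ?n" "j < ?n"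
    show "?A $$ (i, j) * \<sigma> (?v j) = \<sigma> (?v i) * \<bar>?A $$ (i, j)\<bar>"
      using entry[OF ij] abs_entry[OF ij] loop alternating[of "?v i" "?v j"]
      by (auto simp: neighbours_def)
  qed
qed

section \<open>The eigenvalue equation along a path\<close>

text \<open>
  The eigenvalue for which the equation at an inner vertex of a path, a linear recurrence, has the
  solutions \<open>w\<^sup>j\<close> and \<open>w\<^bsup>-j\<^esup>\<close>.
\<close>

definition path_eigenvalue :: "real \<Rightarrow> real \<Rightarrow> real" where
  "path_eigenvalue s w = 1 + s\<^sup>2 + s * (w + 1 / w)"

text \<open>
  The solution of the eigenvalue equation on a path as a function of the distance \<open>j\<close> from its leaf.
  The coefficients are chosen so that the equation holds at the leaf: it has the form of the
  equation at an inner vertex with a fictitious further value \<open>y\<^bsub>-1\<^esub> = -s y\<^sub>0\<close>.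
\<close>

definition branch :: "real \<Rightarrow> real \<Rightarrow> nat \<Rightarrow> real" where
  "branch s w j = (w + s) * w ^ j - (1 / w + s) / w ^ j"

lemma path_eigenvalue_gt_1:
  assumes "s > 0" "w > 1"
  shows "path_eigenvalue s w > 1"
  using assms by (simp add: path_eigenvalue_def add_pos_pos)

lemma path_eigenvalue_less:
  assumes "s > 0" "1 < a" "a < w"
  shows "path_eigenvalue s a < path_eigenvalue s w"
proof -
  have "1 * 1 < a * w" using assms by (intro mult_strict_mono) auto
  then have "(w - a) * (1 - 1 / (a * w)) > 0" using assms by (intro mult_pos_pos) auto
  also have "(w - a) * (1 - 1 / (a * w)) = (w + 1 / w) - (a + 1 / a)"
    using assms by (simp add: field_simps)
  finally show ?thesis using assms by (simp add: path_eigenvalue_def)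
qed

lemma branch_pos:
  assumes "s > 0" "w > 1"
  shows "branch s w j > 0"
proof -
  have 1: "1 / w < w" using assms by (smt (verit) divide_less_eq_1_pos)
  have 2: "w ^ j \<ge> 1" using assms by (simp add: one_le_power)
  have "1 / w + s > 0" using assms by (simp add: add_pos_pos)
  then have "(1 / w + s) * 1 \<le> (1 / w + s) * w ^ j" using 2 by (intro mult_left_mono) auto
  then have "(1 / w + s) / w ^ j \<le> 1 / w + s" using assms
    by (simp add: pos_divide_le_eq)
  also have "\<dots> < w + s" using 1 by simp
  also have "\<dots> \<le> (w + s) * w ^ j" using 2 assms by simp
  finally show ?thesis by (simp add: branch_def)
qed

lemma branch_leaf:
  assumes "w > 0"
  shows "branch s w 0 + s * branch s w 1 = path_eigenvalue s w * branch s w 0"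
  using assms by (simp add: branch_def path_eigenvalue_def field_simps power2_eq_square)

lemma branch_step:
  assumes "w > 0"
  shows "(1 + s\<^sup>2) * branch s w (Suc j) + s * (branch s w j + branch s w (Suc (Suc j)))
    = path_eigenvalue s w * branch s w (Suc j)"
proof -
  define p where "p = w ^ j"
  have "p > 0" using assms by (simp add: p_def)
  with assms show ?thesis
    unfolding branch_def path_eigenvalue_def power_Suc p_def[symmetric]
    by (simp add: field_simps)
qed

text \<open>
  On an infinite path the decaying solution would have the ratio \<open>1/w\<close> exactly; the leaf of a finite
  branch makes the ratio smaller, which is why the radii stay strictly below their limit.
\<close>

lemma branch_ratio_less:
  assumes "s > 0" "w > 1"
  shows "branch s w j / branch s w (Suc j) < 1 / w"
proof -
  have "branch s w (Suc j) - w * branch s w j = (1 / w + s) / w ^ j * (w - 1 / w)"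
    using assms by (simp add: branch_def field_simps)
  moreover have "\<dots> > 0" using assms
    by (intro mult_pos_pos divide_pos_pos add_pos_pos) (auto simp: divide_less_eq less_1_mult)
  ultimately have "w * branch s w j < branch s w (Suc j)" by linarith
  then show ?thesis using branch_pos[OF assms, of "Suc j"] assms
    by (simp add: pos_divide_less_eq pos_less_divide_eq mult.commute)
qed

lemma branch_ratio_tendsto:
  assumes "s > 0" "w > 1"
  shows "(\<lambda>j. branch s w j / branch s w (Suc j)) \<longlonglongrightarrow> 1 / w"
proof -
  let ?q = "(1 / w)\<^sup>2"
  have q: "(\<lambda>j. ?q ^ j) \<longlonglongrightarrow> 0"
    using assms by (intro LIMSEQ_power_zero) (simp add: power_divide one_less_power)
  have "(\<lambda>j. ((w + s) - (1 / w + s) * ?q ^ j) / ((w + s) * w - (1 / w + s) / w * ?q ^ j))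
      \<longlonglongrightarrow> ((w + s) - (1 / w + s) * 0) / ((w + s) * w - (1 / w + s) / w * 0)"
    using assms by (intro tendsto_intros q) auto
  also have "((w + s) - (1 / w + s) * 0) / ((w + s) * w - (1 / w + s) / w * 0) = 1 / w"
    using assms by simp
  also have "(\<lambda>j. ((w + s) - (1 / w + s) * ?q ^ j) / ((w + s) * w - (1 / w + s) / w * ?q ^ j))
      = (\<lambda>j. branch s w j / branch s w (Suc j))"
  proof
    fix j
    define p where "p = w ^ j"
    have p: "p > 0" using assms by (simp add: p_def)
    have q: "?q ^ j = 1 / (p * p)"
      by (simp add: p_def power_divide power_mult_distrib power2_eq_square)
    have "branch s w j = p * ((w + s) - (1 / w + s) * ?q ^ j)"
      unfolding q using p assms by (simp add: branch_def p_def[symmetric] field_simps)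
    moreover have "branch s w (Suc j) = p * ((w + s) * w - (1 / w + s) / w * ?q ^ j)"
      unfolding q using p assms by (simp add: branch_def p_def[symmetric] field_simps)
    ultimately show "((w + s) - (1 / w + s) * ?q ^ j) / ((w + s) * w - (1 / w + s) / w * ?q ^ j)
      = branch s w j / branch s w (Suc j)" using p by simp
  qed
  finally show ?thesis .
qed

section \<open>The spectral radius of the trees\<close>

lemma tree_T_radius:
  assumes s: "s > 0" and w: "w > 1"
    and centre: "s * (w + 1 / w) = s\<^sup>2 + s\<^sup>2 / (path_eigenvalue s w - 1)
      + 2 * s * (branch s w m / branch s w (Suc m))"
  shows "deformed_laplacian_radius (tree_T 1 (Suc m) (Suc m)) s = path_eigenvalue s w"
proof -
  define n where "n = Suc m"
  let ?G = "tree_T 1 n n"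
  let ?y = "branch s w"
  (* The centre is at distance n from the far leaves. The value at the pendant vertex 1 is forced
     by its own equation x 1 + s * x 0 = path_eigenvalue s w * x 1. *)
  define x where "x v = (if v = 0 then ?y n else if v = 1 then s * ?y n / (path_eigenvalue s w - 1)
     else if v \<le> n + 1 then ?y (n + 1 - v) else ?y (2 * n + 1 - v))" for v
  define depth where "depth v = (if v \<le> 1 then v else if v \<le> n + 1 then v - 1 else v - (n + 1))"
    for v :: nat
  have V: "pverts ?G = {0..2 * n + 1}" by (simp add: tree_T_def Let_def)
  have nb: "neighbours ?G v = {u\<in>{1..2*n+1}. tree_T_pred 1 n u = v}
      \<union> (if 1 \<le> v \<and> v \<le> 2 * n + 1 then {tree_T_pred 1 n v} else {})" for v
    by (auto simp: neighbours_def tree_T_def Let_def)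
  have nb0: "neighbours ?G 0 = {1, 2, n + 2}"
    unfolding nb by (auto simp: tree_T_pred_def n_def)
  have nb1: "neighbours ?G 1 = {0}"
    unfolding nb by (auto simp: tree_T_pred_def n_def)
  have leaf: "neighbours ?G v = {tree_T_pred 1 n v}" if "v = n + 1 \<or> v = 2 * n + 1" for v
    unfolding nb using that by (auto simp: tree_T_pred_def n_def)
  have inner: "neighbours ?G v = {tree_T_pred 1 n v, Suc v}"
    if "2 \<le> v" "v \<le> 2 * n" "v \<noteq> n + 1" for v
    unfolding nb using that by (auto simp: tree_T_pred_def n_def)
  have x_pred: "x (tree_T_pred 1 n v) = (if v \<le> n + 1 then ?y (n + 2 - v) else ?y (2 * n + 2 - v))"
    if "2 \<le> v" "v \<le> 2 * n + 1" for v
    using that by (auto simp: x_def tree_T_pred_def n_def Suc_diff_le)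
  have gt_1: "path_eigenvalue s w > 1" using path_eigenvalue_gt_1[OF s w] .
  have vertex_cases: "v = 0 \<or> v = 1
      \<or> (v = n + 1 \<or> v = 2 * n + 1) \<and> 2 \<le> v \<or> 2 \<le> v \<and> v \<le> 2 * n \<and> v \<noteq> n + 1"
    if "v \<le> 2 * n + 1" for v using that by (auto simp: n_def)
  have "deformed_laplacian_radius ?G s = path_eigenvalue s w"
  proof (rule deformed_laplacian_radius_eqI[where x = x and \<sigma> = "\<lambda>v. (- 1) ^ depth v"])
    show "pair_graph ?G" by (rule pair_graph_tree_T)
    show "pverts ?G \<noteq> {}" unfolding V by simp
    show "s \<ge> 0" using s by simp
    show "\<bar>(- 1 :: real) ^ depth v\<bar> = 1" for v by (simp add: power_abs)
  next
    fix v assume "v \<in> pverts ?G"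
    then have v: "v \<le> 2 * n + 1" unfolding V by simp
    show "neighbours ?G v \<noteq> {}" using vertex_cases[OF v] nb0 nb1 leaf[of v] inner[of v] by auto
    show "x v > 0" using branch_pos[OF s w] gt_1 s by (simp add: x_def)
    show "(1 + s\<^sup>2 * (real (card (neighbours ?G v)) - 1)) * x v + s * (\<Sum>u\<in>neighbours ?G v. x u)
      = path_eigenvalue s w * x v"
    proof -
      consider (at_centre) "v = 0" | (at_pendant) "v = 1"
        | (at_leaf) "v = n + 1 \<or> v = 2 * n + 1" "2 \<le> v"
        | (at_inner) "2 \<le> v" "v \<le> 2 * n" "v \<noteq> n + 1"
        using vertex_cases[OF v] by metis
      then show ?thesis
      proof cases
        case v0: at_centre
        have "path_eigenvalue s w = 1 + 2 * s\<^sup>2 + s\<^sup>2 / (path_eigenvalue s w - 1) + 2 * s * (?y m / ?y n)"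
          using centre by (simp add: path_eigenvalue_def[of s w] n_def)
        then have "path_eigenvalue s w * ?y n =
            (1 + 2 * s\<^sup>2 + s\<^sup>2 / (path_eigenvalue s w - 1) + 2 * s * (?y m / ?y n)) * ?y n"
          by simp
        also have "\<dots> = (1 + 2 * s\<^sup>2) * ?y n + s * (s * ?y n / (path_eigenvalue s w - 1) + 2 * ?y m)"
          using branch_pos[OF s w, of n] gt_1 by (simp add: field_simps power2_eq_square)
        finally show ?thesis unfolding v0 nb0 by (simp add: x_def n_def mult.commute)
      next
        case v1: at_pendant
        show ?thesis unfolding v1 nb1 using gt_1 by (simp add: x_def field_simps)
      next
        case v: at_leaf
        have "x v = branch s w 0" using v by (auto simp: x_def n_def)
        moreover have "x (tree_T_pred 1 n v) = branch s w 1"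
          using v by (subst x_pred) (auto simp: n_def)
        ultimately show ?thesis using leaf[OF v(1)] branch_leaf[of w s] w by simp
      next
        case v: at_inner
        define j where "j = (if v \<le> n + 1 then n - v else 2 * n - v)"
        have "x (Suc v) = ?y j" "x v = ?y (Suc j)"
          using v by (auto simp: x_def j_def Suc_diff_le)
        moreover have "x (tree_T_pred 1 n v) = ?y (Suc (Suc j))"
          using v by (subst x_pred) (auto simp: j_def Suc_diff_le)
        moreover have "tree_T_pred 1 n v \<noteq> Suc v" by (auto simp: tree_T_pred_def)
        ultimately show ?thesis using inner[OF v] branch_step[of w s j] w by (simp add: add.commute)
      qed
    qed
  next
    fix u v assume "(u, v) \<in> parcs ?G"
    moreover have "depth v = Suc (depth (tree_T_pred 1 n v))" if "v \<in> {1..2*n+1}" for v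
      using that by (auto simp: depth_def tree_T_pred_def n_def)
    ultimately show "(- 1 :: real) ^ depth v = - ((- 1) ^ depth u)"
      by (auto simp: tree_T_def Let_def)
  qed
  then show ?thesis by (simp add: n_def)
qed

section \<open>The limiting equation at the centre\<close>

text \<open>
  For fixed \<open>l\<close>, the limiting equation determines \<open>s\<close> as a continuous function of \<open>W\<close>. Along this
  curve the eigenvalue is 1 at \<open>W = 1\<close> and unbounded as \<open>W\<close> grows, so it takes the value \<open>l\<close>.
\<close>

lemma limit_parameters_exist:
  assumes l: "l > 1"
  obtains s W where "s > 0" "W > 1" "path_eigenvalue s W = l" "W - 1 / W = s * (l / (l - 1))"
proof -
  define s where "s w = (w - 1 / w) * ((l - 1) / l)" for w :: real
  (* An explicit end point that is large enough for s b >= l - 1. *)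
  define b where "b = 2 + l / (l - 1) * l"
  have b: "b > 1" using l by (simp add: b_def add_pos_pos)
  have "s b \<ge> l - 1"
  proof -
    have "1 / b \<le> 1" using b by simp
    then have "l / (l - 1) * l \<le> b - 1 / b" unfolding b_def by linarith
    then have "l / (l - 1) * l * ((l - 1) / l) \<le> s b"
      unfolding s_def using l by (intro mult_right_mono) auto
    then show ?thesis using l by simp
  qed
  moreover have "b + 1 / b \<ge> 1" using b by (simp add: add_increasing2)
  ultimately have "s b * (b + 1 / b) \<ge> (l - 1) * 1"
    using l by (intro mult_mono) auto
  then have "1 + 0 + (l - 1) * 1 \<le> path_eigenvalue (s b) b"
    unfolding path_eigenvalue_def by (intro add_mono) auto
  then have hi: "l \<le> path_eigenvalue (s b) b" by simp
  have "path_eigenvalue (s 1) 1 \<le> l" using l by (simp add: path_eigenvalue_def s_def)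
  moreover have "continuous_on {1..b} (\<lambda>w. path_eigenvalue (s w) w)"
    unfolding path_eigenvalue_def s_def by (intro continuous_intros) auto
  ultimately obtain W where W: "1 \<le> W" "W \<le> b" "path_eigenvalue (s W) W = l"
    using IVT'[of "\<lambda>w. path_eigenvalue (s w) w" 1 l b] hi b by auto
  have "W \<noteq> 1" using W(3) l by (auto simp: path_eigenvalue_def s_def)
  then have W1: "W > 1" using W(1) by simp
  then have "W - 1 / W > 0" by (simp add: divide_less_eq less_1_mult)
  then have "s W > 0" using l by (simp add: s_def)
  moreover have "W - 1 / W = s W * (l / (l - 1))" using l by (simp add: s_def)
  ultimately show ?thesis using that W1 W(3) by blast
qed

text \<open>
  The centre equation is \<open>F m w = 0\<close>, with \<open>F m\<close> tending pointwise to \<open>F_lim\<close>. As \<open>F_lim\<close> is strictly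
  increasing with zero \<open>W\<close>, it is negative at \<open>a\<close>, hence so is \<open>F m\<close> for large \<open>m\<close>. At \<open>W\<close> the
  strict inequality \<open>branch_ratio_less\<close> makes \<open>F m\<close> positive for every \<open>m\<close>.
\<close>

lemma eventually_radius_between:
  assumes s: "s > 0" and W: "W - 1 / W = s * (path_eigenvalue s W / (path_eigenvalue s W - 1))"
    and a: "1 < a" "a < W"
  shows "\<forall>\<^sub>F n in sequentially. path_eigenvalue s a < deformed_laplacian_radius (tree_T 1 n n) s
           \<and> deformed_laplacian_radius (tree_T 1 n n) s < path_eigenvalue s W"
proof -
  define F where "F m w = s * (w + 1 / w) - s\<^sup>2 - s\<^sup>2 / (path_eigenvalue s w - 1)
      - 2 * s * (branch s w m / branch s w (Suc m))"
    for m w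
  define F_lim where "F_lim w = s * (w - 1 / w) - s\<^sup>2 - s\<^sup>2 / (path_eigenvalue s w - 1)" for w
  have W1: "W > 1" using a by simp
  have zero: "F_lim W = 0"
    unfolding F_lim_def W using path_eigenvalue_gt_1[OF s W1]
    by (simp add: field_simps power2_eq_square)
  have "s\<^sup>2 / (path_eigenvalue s W - 1) < s\<^sup>2 / (path_eigenvalue s a - 1)"
    using path_eigenvalue_less[OF s a] path_eigenvalue_gt_1[OF s a(1)] s
    by (intro divide_strict_left_mono mult_pos_pos) auto
  moreover have "s * (a - 1 / a) < s * (W - 1 / W)"
    using a s by (intro mult_strict_left_mono diff_strict_mono divide_strict_left_mono) auto
  ultimately have "F_lim a < 0" using zero by (simp add: F_lim_def)
  have "(\<lambda>m. F m a) \<longlonglongrightarrow> s * (a + 1 / a) - s\<^sup>2 - s\<^sup>2 / (path_eigenvalue s a - 1) - 2 * s * (1 / a)"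
    unfolding F_def by (intro tendsto_intros branch_ratio_tendsto s a)
  also have "s * (a + 1 / a) - s\<^sup>2 - s\<^sup>2 / (path_eigenvalue s a - 1) - 2 * s * (1 / a) = F_lim a"
    by (simp add: F_lim_def algebra_simps)
  finally have "\<forall>\<^sub>F m in sequentially. F m a < 0"
    using \<open>F_lim a < 0\<close> by (rule order_tendstoD(2))
  then have "\<forall>\<^sub>F m in sequentially. path_eigenvalue s a < deformed_laplacian_radius (tree_T 1 (Suc m) (Suc m)) s
           \<and> deformed_laplacian_radius (tree_T 1 (Suc m) (Suc m)) s < path_eigenvalue s W"
  proof eventually_elim
    case (elim m)
    have "2 * s * (branch s W m / branch s W (Suc m)) < 2 * s * (1 / W)"
      using branch_ratio_less[OF s W1] s by (intro mult_strict_left_mono) auto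
    then have FW: "F m W > 0" using zero by (simp add: F_def F_lim_def algebra_simps)
    have "continuous_on {a..W} (F m)"
    proof -
      have "path_eigenvalue s w - 1 \<noteq> 0" "branch s w (Suc m) \<noteq> 0" "w \<noteq> 0" if "w \<in> {a..W}" for w
        using path_eigenvalue_gt_1[OF s, of w] branch_pos[OF s, of w "Suc m"] that a by auto
      moreover from this have "continuous_on {a..W} (path_eigenvalue s)"
        "continuous_on {a..W} (\<lambda>w. branch s w j)" for j
        unfolding path_eigenvalue_def branch_def by (intro continuous_intros; auto)+
      ultimately show ?thesis unfolding F_def by (intro continuous_intros) auto
    qed
    then obtain w where w: "a \<le> w" "w \<le> W" "F m w = 0"
      using IVT'[of "F m" a 0 W] elim FW a by auto
    have "w \<noteq> a" "w \<noteq> W" using w(3) elim FW by auto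
    then have aw: "a < w" "w < W" using w by auto
    have "deformed_laplacian_radius (tree_T 1 (Suc m) (Suc m)) s = path_eigenvalue s w"
      using w(3) aw a s by (intro tree_T_radius) (auto simp: F_def)
    then show ?case
      using path_eigenvalue_less[OF s, of a w] path_eigenvalue_less[OF s, of w W] aw a by simp
  qed
  then show ?thesis
    using eventually_sequentially_Suc[where P="\<lambda>n. path_eigenvalue s a < deformed_laplacian_radius (tree_T 1 n n) s
           \<and> deformed_laplacian_radius (tree_T 1 n n) s < path_eigenvalue s W"] by simp
qed

section \<open>Every number above 1 is a limit point\<close>

lemma strict_mono_subsequence:
  fixes X :: "nat \<Rightarrow> real"
  assumes lim: "X \<longlonglongrightarrow> l" and below: "\<forall>\<^sub>F n in sequentially. X n < l"
  obtains k :: "nat \<Rightarrow> nat" where "strict_mono k" "strict_mono (X \<circ> k)"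
proof -
  have "\<exists>k. \<forall>n. X (k n) < l \<and> (k n < k (Suc n) \<and> X (k n) < X (k (Suc n)))"
  proof (rule dependent_nat_choice)
    show "\<exists>i. X i < l" using eventually_happens'[OF _ below] by auto
  next
    fix i n :: nat assume "X i < l"
    then have "\<forall>\<^sub>F j in sequentially. X i < X j" using lim by (simp add: order_tendsto_iff)
    then have "\<forall>\<^sub>F j in sequentially. X j < l \<and> i < j \<and> X i < X j"
      using below eventually_gt_at_top[of i] by eventually_elim auto
    then show "\<exists>j. X j < l \<and> (i < j \<and> X i < X j)"
      using eventually_happens'[OF sequentially_bot] by blast
  qed
  then obtain k where "\<forall>n. k n < k (Suc n) \<and> X (k n) < X (k (Suc n))" by blast
  then have "strict_mono k" "strict_mono (X \<circ> k)" by (auto simp: strict_mono_Suc_iff)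
  then show ?thesis by (rule that)
qed

theorem theorem1:
  fixes l :: real
  assumes "l > 1"
  shows "\<exists>s>0. deformed_laplacian_limit_point s l \<and>
               (\<lambda>n. deformed_laplacian_radius (tree_T 1 n n) s) \<longlonglongrightarrow> l"
proof -
  obtain s W where s: "s > 0" and W: "W > 1" and l: "path_eigenvalue s W = l"
    and eq: "W - 1 / W = s * (l / (l - 1))"
    using limit_parameters_exist[OF assms] .
  let ?R = "\<lambda>n. deformed_laplacian_radius (tree_T 1 n n) s"
  have between: "\<forall>\<^sub>F n in sequentially. path_eigenvalue s a < ?R n \<and> ?R n < l" if "1 < a" "a < W" for a
    using eventually_radius_between[OF s _ that] eq l by simp
  obtain c where "1 < c" "c < W" using dense[OF W] by blast
  from between[OF this] have below: "\<forall>\<^sub>F n in sequentially. ?R n < l" by eventually_elim simp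
  have lim: "?R \<longlonglongrightarrow> l"
  proof (rule order_tendstoI)
    fix b assume b: "b < l"
    have "((\<lambda>w. path_eigenvalue s w) \<longlongrightarrow> path_eigenvalue s W) (at_left W)"
      unfolding path_eigenvalue_def using W by (intro tendsto_intros) auto
    then have "\<forall>\<^sub>F a in at_left W. b < path_eigenvalue s a" using b l by (intro order_tendstoD) auto
    then have "\<forall>\<^sub>F a in at_left W. b < path_eigenvalue s a \<and> a \<in> {1<..<W}"
      using eventually_at_left_real[OF W] by eventually_elim auto
    then obtain a where a: "b < path_eigenvalue s a" "1 < a" "a < W"
      using eventually_happens'[OF trivial_limit_at_left_real] by auto
    from between[OF a(2,3)] show "\<forall>\<^sub>F n in sequentially. b < ?R n"
      by eventually_elim (use a(1) in simp)
  next
    fix b assume "l < b"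
    with below show "\<forall>\<^sub>F n in sequentially. ?R n < b" by (auto elim: eventually_mono)
  qed
  obtain k :: "nat \<Rightarrow> nat" where k: "strict_mono k" "strict_mono (?R \<circ> k)"
    using strict_mono_subsequence[OF lim below] by blast
  have "deformed_laplacian_limit_point s l"
    unfolding deformed_laplacian_limit_point_def
  proof (intro exI[of _ "\<lambda>n. tree_T 1 (k n) (k n)"] conjI allI impI)
    show "pair_graph (tree_T 1 (k n) (k n))" for n by (rule pair_graph_tree_T)
    show "pverts (tree_T 1 (k n) (k n)) \<noteq> {}" for n by (simp add: tree_T_def Let_def)
    show "?R (k i) \<noteq> ?R (k j)" if "i \<noteq> j" for i j
      using that strict_mono_eq[OF k(2)] by simp
    show "(\<lambda>n. ?R (k n)) \<longlonglongrightarrow> l"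
      using LIMSEQ_subseq_LIMSEQ[OF lim k(1)] by (simp add: o_def)
  qed
  then show ?thesis using s lim by blast
qed

end
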